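(* Let $A_0\subseteq\mathbb{N}$ be the Thue–Morse set, i.e. the set of nonnegative integers whose binary representation contains an even number of ones. For a set $A\subseteq\mathbb{N}$ and an integer $n$, let $R_2(A,n)$ be the number of pairs $(a,a')$ with $a,a'\in A$, $a<a'$ and $a+a'=n$. Then for every $\theta$ with $0<\theta<\frac{2\log 2-\log 3}{40\log 2-8\log 3}$ there exist $\delta=\delta(\theta)>0$ and constants $C,C'>0$ (depending on $\theta$) such that for all real $x\ge 1$, $$\Bigl|\,\#\{n\in\mathbb{N}: 1\le n\le x,\ |R_2(A_0,n)-\tfrac{n}{8}|\le C n^{1-\theta}\} - x\,\Bigr|\le C' x^{1-\delta}.$$ In the paper's notation: $|\{n\le x: R_2(A_0,n)=\frac n8+O(n^{1-\theta})\}|=x+O(x^{1-\delta})$.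
   Context: $\mathbb{N}$ denotes the set of nonnegative integers. $A_0$ is the set of $n\in\mathbb{N}$ having an even number of ones in binary. $R_2(A,n)=\#\{(a,a')\in A\times A: a<a',\ a+a'=n\}$. *)

theory Defs
  imports Complex_Main
begin

definition thue_morse_set :: "nat set" where
  "thue_morse_set = {n. even (card {k. bit n k})}"

text \<open>\<^const>\<open>card\<close> is 0 on infinite sets; the following rules that case out.\<close>

lemma finite_bits_nat: "finite {k. bit (n::nat) k}"
proof (rule finite_subset)
  show "{k. bit n k} \<subseteq> {..<n}"
  proof
    fix k assume "k \<in> {k. bit n k}"
    then have "odd (n div 2 ^ k)" by (simp add: bit_iff_odd)
    then have "2 ^ k \<le> n" by (metis div_less even_zero not_le)
    moreover have "k < 2 ^ k" by simp
    ultimately show "k \<in> {..<n}" by (metis lessThan_iff less_le_trans)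
  qed
qed simp

definition R2 :: "nat set \<Rightarrow> nat \<Rightarrow> nat" where
  "R2 A n = card {(a, a'). a \<in> A \<and> a' \<in> A \<and> a < a' \<and> a + a' = n}"

lemma finite_R2_pairs: "finite {(a, a'). a \<in> A \<and> a' \<in> A \<and> a < a' \<and> a + a' = (n::nat)}"
  by (rule finite_subset[of _ "{..n} \<times> {..n}"]) auto

end

theory Submission
  imports Defs
begin

text \<open>
  Let \<open>t\<close> be the Thue--Morse sign and \<open>c\<close> its self-convolution. Expanding the indicator function
  \<open>(1 + t) / 2\<close> gives \<open>8 R\<^sub>2(A\<^sub>0, n) = n + c(n) + O(1)\<close>, so it suffices to bound \<open>c\<close> in mean
  square. The generating function \<open>T(z) = (1 - z) T(z\<^sup>2)\<close> yields \<open>c(2n) = c(n) + c(n - 1)\<close> and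
  \<open>c(2n + 1) = -2 c(n)\<close>; hence the sums of \<open>c(n)\<^sup>2\<close> and \<open>c(n) c(n - 1)\<close> over \<open>n < 2\<^sup>N\<close> satisfy a
  linear recursion in \<open>N\<close> whose growth rate is \<open>1 + \<surd>17 < 6\<close>, well below the trivial rate \<open>8\<close>.
  Chebyshev's inequality then bounds the number of exceptional \<open>n\<close>.
\<close>

section \<open>Signs of the Thue-Morse sequence\<close>

definition tm_sign :: "nat \<Rightarrow> real" where
  "tm_sign n = (if n \<in> thue_morse_set then 1 else -1)"

lemma tm_sign_double: "tm_sign (2 * n) = tm_sign n"
proof -
  have "{k. bit (2 * n) k} = Suc ` {k. bit n k}"
  proof (rule set_eqI)
    fix k show "k \<in> {k. bit (2 * n) k} \<longleftrightarrow> k \<in> Suc ` {k. bit n k}"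
      by (cases k) (auto simp: bit_0 bit_Suc)
  qed
  then have "card {k. bit (2 * n) k} = card {k. bit n k}"
    by (simp add: card_image)
  then show ?thesis by (simp add: tm_sign_def thue_morse_set_def)
qed

lemma tm_sign_double_Suc: "tm_sign (Suc (2 * n)) = - tm_sign n"
proof -
  have "{k. bit (Suc (2 * n)) k} = insert 0 (Suc ` {k. bit n k})"
  proof (rule set_eqI)
    fix k show "k \<in> {k. bit (Suc (2 * n)) k} \<longleftrightarrow> k \<in> insert 0 (Suc ` {k. bit n k})"
      by (cases k) (auto simp: bit_0 bit_Suc)
  qed
  then have "card {k. bit (Suc (2 * n)) k} = Suc (card {k. bit n k})"
    by (simp add: card_image finite_bits_nat)
  then show ?thesis by (simp add: tm_sign_def thue_morse_set_def)
qed

lemma sum_lessThan_double: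
  fixes f :: "nat \<Rightarrow> 'a::comm_monoid_add"
  shows "(\<Sum>n<2 * m. f n) = (\<Sum>n<m. f (2 * n) + f (Suc (2 * n)))"
  by (induction m) (auto simp: ac_simps)

text \<open>The signs at 2m and 2m + 1 cancel, so at most one term survives. This makes the linear
  terms in the expansion of \<open>R2\<close> bounded.\<close>

lemma abs_sum_tm_sign_le_1: "\<bar>\<Sum>a<n. tm_sign a\<bar> \<le> 1"
proof -
  have even: "(\<Sum>a<2 * m. tm_sign a) = 0" for m
    by (simp add: sum_lessThan_double tm_sign_double tm_sign_double_Suc)
  show ?thesis
  proof (cases "even n")
    case True
    then show ?thesis using even by (auto elim!: evenE)
  next
    case False
    then obtain m where "n = Suc (2 * m)" by (auto elim!: oddE)
    then show ?thesis using even[of m] by (simp add: tm_sign_def)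
  qed
qed

section \<open>The self-convolution and its dyadic recursion\<close>

definition tm_conv :: "nat \<Rightarrow> real" where
  "tm_conv n = (\<Sum>a\<le>n. tm_sign a * tm_sign (n - a))"

text \<open>Encodes c(n - 1) with the convention c(-1) = 0; truncated subtraction alone would give
  c(0) at n = 0.\<close>

definition tm_conv_pred :: "nat \<Rightarrow> real" where
  "tm_conv_pred n = (if n = 0 then 0 else tm_conv (n - 1))"

text \<open>Two summands of an odd number have opposite parity, so each product carries exactly one
  minus sign; the two parity classes of a contribute equally.\<close>

lemma tm_conv_double_Suc: "tm_conv (Suc (2 * n)) = - 2 * tm_conv n"
proof -
  let ?f = "\<lambda>a. tm_sign a * tm_sign (Suc (2 * n) - a)"
  have "tm_conv (Suc (2 * n)) = (\<Sum>a<2 * Suc n. ?f a)"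
    unfolding tm_conv_def by (simp add: lessThan_Suc_atMost[symmetric])
  also have "\<dots> = (\<Sum>a<Suc n. ?f (2 * a) + ?f (Suc (2 * a)))"
    by (rule sum_lessThan_double)
  also have "\<dots> = (\<Sum>a<Suc n. - 2 * (tm_sign a * tm_sign (n - a)))"
  proof (rule sum.cong[OF refl])
    fix a assume "a \<in> {..<Suc n}"
    then have "Suc (2 * n) - 2 * a = Suc (2 * (n - a))"
      and "Suc (2 * n) - Suc (2 * a) = 2 * (n - a)" by auto
    then show "?f (2 * a) + ?f (Suc (2 * a)) = - 2 * (tm_sign a * tm_sign (n - a))"
      by (simp only: tm_sign_double tm_sign_double_Suc mult_minus_left mult_minus_right)
  qed
  finally show ?thesis
    by (simp only: tm_conv_def sum_distrib_left lessThan_Suc_atMost)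
qed

text \<open>Here both summands have the same parity: even pairs halve to pairs with sum n, while odd
  pairs lose both minus signs and halve to pairs with sum n - 1.\<close>

lemma tm_conv_double: "tm_conv (2 * n) = tm_conv n + tm_conv_pred n"
proof -
  let ?f = "\<lambda>a. tm_sign a * tm_sign (2 * n - a)"
  \<comment> \<open>The term a = 2n is split off to leave a range of even length; it rejoins the
    even terms at the end.\<close>
  have "tm_conv (2 * n) = (\<Sum>a<2 * n. ?f a) + ?f (2 * n)"
    unfolding tm_conv_def by (simp flip: lessThan_Suc_atMost)
  also have "(\<Sum>a<2 * n. ?f a) = (\<Sum>a<n. ?f (2 * a)) + (\<Sum>a<n. ?f (Suc (2 * a)))"
    by (simp only: sum_lessThan_double sum.distrib)
  also have "(\<Sum>a<n. ?f (2 * a)) = (\<Sum>a<n. tm_sign a * tm_sign (n - a))"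
    by (simp add: tm_sign_double flip: diff_mult_distrib2)
  also have "(\<Sum>a<n. ?f (Suc (2 * a))) = (\<Sum>a<n. tm_sign a * tm_sign (n - 1 - a))"
  proof (rule sum.cong[OF refl])
    fix a assume "a \<in> {..<n}"
    then have "2 * n - Suc (2 * a) = Suc (2 * (n - 1 - a))" by auto
    then show "?f (Suc (2 * a)) = tm_sign a * tm_sign (n - 1 - a)"
      by (simp only: tm_sign_double_Suc mult_minus_left mult_minus_right minus_minus)
  qed
  also have "\<dots> = tm_conv_pred n"
    by (cases n) (simp_all add: tm_conv_pred_def tm_conv_def lessThan_Suc_atMost)
  finally show ?thesis
    unfolding tm_conv_def[of n] by (simp add: tm_sign_double flip: lessThan_Suc_atMost)
qed

lemma tm_conv_pred_double_Suc: "tm_conv_pred (Suc (2 * n)) = tm_conv n + tm_conv_pred n"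
  by (simp add: tm_conv_pred_def[of "Suc _"] tm_conv_double)

lemma tm_conv_pred_double: "tm_conv_pred (2 * n) = - 2 * tm_conv_pred n"
proof (cases n)
  case (Suc m)
  then show ?thesis using tm_conv_double_Suc[of m] by (simp add: tm_conv_pred_def)
qed (simp add: tm_conv_pred_def)

section \<open>Mean square up to powers of two\<close>

lemma sum_tm_conv_pred_sq_le: "(\<Sum>n<m. (tm_conv_pred n)\<^sup>2) \<le> (\<Sum>n<m. (tm_conv n)\<^sup>2)"
proof (cases m)
  case (Suc k)
  have "(\<Sum>n<Suc k. (tm_conv_pred n)\<^sup>2) = (\<Sum>n<k. (tm_conv n)\<^sup>2)"
    by (simp add: sum.lessThan_Suc_shift tm_conv_pred_def del: sum.lessThan_Suc)
  then show ?thesis using Suc by simp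
qed simp

lemma sum_tm_conv_sq_le: "(\<Sum>n<2 ^ N. (tm_conv n)\<^sup>2) \<le> 2 * 6 ^ N"
proof -
  define P where "P N = (\<Sum>n<2 ^ N. (tm_conv n)\<^sup>2)" for N :: nat
  define D where "D N = (\<Sum>n<2 ^ N. (tm_conv_pred n)\<^sup>2)" for N :: nat
  define Q where "Q N = (\<Sum>n<2 ^ N. tm_conv n * tm_conv_pred n)" for N :: nat
  have P_Suc: "P (Suc N) = 5 * P N + D N + 2 * Q N" for N
  proof -
    have "P (Suc N) = (\<Sum>n<2 ^ N. (tm_conv (2 * n))\<^sup>2 + (tm_conv (Suc (2 * n)))\<^sup>2)"
      by (simp add: P_def sum_lessThan_double)
    also have "\<dots> = (\<Sum>n<2 ^ N. 5 * (tm_conv n)\<^sup>2 + (tm_conv_pred n)\<^sup>2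
        + 2 * (tm_conv n * tm_conv_pred n))"
      by (simp only: tm_conv_double tm_conv_double_Suc)
        (simp add: power2_eq_square algebra_simps)
    finally show ?thesis by (simp add: P_def D_def Q_def sum.distrib sum_distrib_left)
  qed
  have Q_Suc: "Q (Suc N) = - 2 * P N - 2 * D N - 4 * Q N" for N
  proof -
    have "Q (Suc N) = (\<Sum>n<2 ^ N. tm_conv (2 * n) * tm_conv_pred (2 * n)
        + tm_conv (Suc (2 * n)) * tm_conv_pred (Suc (2 * n)))"
      by (simp add: Q_def sum_lessThan_double)
    also have "\<dots> = (\<Sum>n<2 ^ N. - 2 * (tm_conv n)\<^sup>2 - 2 * (tm_conv_pred n)\<^sup>2
        - 4 * (tm_conv n * tm_conv_pred n))"
      by (simp only: tm_conv_double tm_conv_double_Suc tm_conv_pred_double tm_conv_pred_double_Suc)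
        (simp add: power2_eq_square algebra_simps)
    finally show ?thesis
      by (simp add: P_def D_def Q_def sum_subtractf sum_distrib_left sum_negf)
  qed
  \<comment> \<open>\<open>D\<close> is \<open>P\<close> with its last square missing; bounding it
    by \<open>P\<close> closes the recursion in \<open>P\<close> and \<open>Q\<close>.\<close>
  have D_le: "D N \<le> P N" for N
    unfolding P_def D_def by (rule sum_tm_conv_pred_sq_le)
  have P_nonneg: "0 \<le> P N" for N
    unfolding P_def by (intro sum_nonneg) simp
  have PQ_nonneg: "0 \<le> P N + Q N" for N
  proof -
    have "0 \<le> (\<Sum>n<2 ^ N. (tm_conv n + tm_conv_pred n)\<^sup>2)" by (intro sum_nonneg) simp
    also have "\<dots> = P N + D N + 2 * Q N"
      by (simp add: P_def D_def Q_def power2_sum sum.distrib sum_distrib_left mult.assoc)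
    finally show ?thesis using D_le[of N] by simp
  qed
  \<comment> \<open>\<open>(1, 1/4)\<close> approximates the left eigenvector of the recursion for its dominant eigenvalue.\<close>
  have "P N + Q N / 4 \<le> 6 ^ N" for N
  proof (induction N)
    case 0
    show ?case by (simp add: P_def Q_def tm_conv_def tm_conv_pred_def tm_sign_def)
  next
    case (Suc N)
    \<comment> \<open>The new value is 9P/2 + D/2 + Q \<le> 5P + Q. It stays below 6 (P + Q/4)
      because P + Q/2 is the mean of the nonnegative numbers P and P + Q.\<close>
    then show ?case
      using P_Suc[of N] Q_Suc[of N] D_le[of N] P_nonneg[of N] PQ_nonneg[of N]
      by (simp add: field_simps)
  qed
  \<comment> \<open>Since Q \<ge> -P, the bound gives 3P/4 \<le> 6^N, which is stronger than the
    factor 2 claimed.\<close>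
  from this[of N] show ?thesis
    using P_nonneg[of N] PQ_nonneg[of N] unfolding P_def by simp
qed

section \<open>Ordered pairs and the comparison of \<open>R2\<close> with n/8\<close>

lemma R2_eq_card_lower: "R2 A n = card {a. a \<in> A \<and> n - a \<in> A \<and> 2 * a < n}"
proof -
  have "{(a, a'). a \<in> A \<and> a' \<in> A \<and> a < a' \<and> a + a' = n}
      = (\<lambda>a. (a, n - a)) ` {a. a \<in> A \<and> n - a \<in> A \<and> 2 * a < n}"
    by (force simp: image_iff)
  then show ?thesis by (simp add: R2_def card_image inj_on_def)
qed

text \<open>Parametrizes a pair by its larger member, complementing the previous lemma. The
  condition \<open>a \<le> n\<close> guards against truncation in \<open>n - a\<close>; above it
  followed from \<open>2 * a < n\<close>.\<close>

lemma R2_eq_card_upper: "R2 A n = card {a. a \<in> A \<and> n - a \<in> A \<and> a \<le> n \<and> n < 2 * a}"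
proof -
  have "{(a, a'). a \<in> A \<and> a' \<in> A \<and> a < a' \<and> a + a' = n}
      = (\<lambda>a. (n - a, a)) ` {a. a \<in> A \<and> n - a \<in> A \<and> a \<le> n \<and> n < 2 * a}"
    by (force simp: image_iff)
  then show ?thesis by (simp add: R2_def card_image inj_on_def)
qed

text \<open>Each pair counted by \<open>R2\<close> gives two ordered solutions, and the diagonal a =
  n - a adds at most one more.\<close>

lemma card_ordered_pairs_R2:
  "2 * R2 A n \<le> card {a \<in> {..n}. a \<in> A \<and> n - a \<in> A}"
  "card {a \<in> {..n}. a \<in> A \<and> n - a \<in> A} \<le> Suc (2 * R2 A n)"
proof -
  let ?S = "{a \<in> {..n}. a \<in> A \<and> n - a \<in> A}"
  let ?L = "{a. a \<in> A \<and> n - a \<in> A \<and> 2 * a < n}"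
  let ?U = "{a. a \<in> A \<and> n - a \<in> A \<and> a \<le> n \<and> n < 2 * a}"
  have fin: "finite ?L" "finite ?U"
    by (rule finite_subset[of _ "{..n}"], auto)+
  have LU: "card (?L \<union> ?U) = 2 * R2 A n"
    using fin by (subst card_Un_disjoint)
      (auto simp flip: R2_eq_card_lower R2_eq_card_upper)
  have "card (?L \<union> ?U) \<le> card ?S"
    by (rule card_mono) auto
  then show "2 * R2 A n \<le> card ?S" by (simp only: LU)
  \<comment> \<open>\<open>n div 2\<close> is the only possible diagonal solution for even n; for
    odd n inserting it is harmless.\<close>
  have "card ?S \<le> card (insert (n div 2) (?L \<union> ?U))"
    by (rule card_mono) (use fin in auto)
  also have "\<dots> \<le> Suc (card (?L \<union> ?U))"
    by (rule card_insert_le_m1) auto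
  finally show "card ?S \<le> Suc (2 * R2 A n)" by (simp only: LU)
qed

lemma abs_R2_thue_morse_diff_le:
  "\<bar>real (R2 thue_morse_set n) - real n / 8\<bar> \<le> (\<bar>tm_conv n\<bar> + 5) / 8"
proof -
  define s where "s = real (card {a \<in> {..n}. a \<in> thue_morse_set \<and> n - a \<in> thue_morse_set})"
  have "4 * s = (\<Sum>a\<le>n. (1 + tm_sign a) * (1 + tm_sign (n - a)))"
  proof -
    have "4 * s = (\<Sum>a\<le>n. if a \<in> thue_morse_set \<and> n - a \<in> thue_morse_set then 4 else 0)"
      unfolding s_def by (simp flip: sum.inter_filter)
    then show ?thesis by (auto simp: tm_sign_def intro!: sum.cong)
  qed
  also have "\<dots> = real n + 1 + (\<Sum>a\<le>n. tm_sign a) + (\<Sum>a\<le>n. tm_sign (n - a)) + tm_conv n"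
    by (simp add: tm_conv_def algebra_simps sum.distrib)
  also have "(\<Sum>a\<le>n. tm_sign (n - a)) = (\<Sum>a\<le>n. tm_sign a)"
    by (rule sum.nat_diff_reindex[of tm_sign "Suc n", simplified lessThan_Suc_atMost, simplified])
  finally have "4 * s = real n + 1 + 2 * (\<Sum>a\<le>n. tm_sign a) + tm_conv n"
    by simp
  moreover have "\<bar>\<Sum>a\<le>n. tm_sign a\<bar> \<le> 1"
    using abs_sum_tm_sign_le_1[of "Suc n"] by (simp only: lessThan_Suc_atMost)
  moreover have "2 * real (R2 thue_morse_set n) \<le> s" "s \<le> 2 * real (R2 thue_morse_set n) + 1"
    using card_ordered_pairs_R2[where A = thue_morse_set and n = n] unfolding s_def by linarith+
  \<comment> \<open>With S the sum of signs and d = s - 2 R2 in [0, 1], 8 R2 - n - c(n) = 1 + 2S -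
    4d lies in [-5, 3]; hence the constant 5.\<close>
  ultimately show ?thesis by (simp add: abs_le_iff field_simps) linarith
qed

section \<open>Counting the exceptional integers\<close>

lemma sum_tm_conv_sq_le_powr:
  assumes "x \<ge> 1"
  shows "(\<Sum>n | real n \<le> x. (tm_conv n)\<^sup>2) \<le> 12 * x powr (13 / 5)"
proof -
  define M where "M = nat \<lfloor>log 2 x\<rfloor>"
  have "0 \<le> log 2 x" using assms by simp
  then have M: "real M \<le> log 2 x" "log 2 x < real (Suc M)"
    unfolding M_def by linarith+
  have lower: "2 ^ M \<le> x" and upper: "x < 2 ^ Suc M"
    using M assms by (simp_all add: le_log_iff log_less_iff powr_realpow del: of_nat_Suc power_Suc)
  have "(\<Sum>n | real n \<le> x. (tm_conv n)\<^sup>2) \<le> (\<Sum>n<2 ^ Suc M. (tm_conv n)\<^sup>2)"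
  proof (rule sum_mono2)
    show "{n. real n \<le> x} \<subseteq> {..<2 ^ Suc M}"
    proof
      fix n assume "n \<in> {n. real n \<le> x}"
      then have "real n < real (2 ^ Suc M)" using upper by simp
      then show "n \<in> {..<2 ^ Suc M}" by (simp only: of_nat_less_iff lessThan_iff)
    qed
  qed auto
  also have "\<dots> \<le> 2 * 6 ^ Suc M" by (rule sum_tm_conv_sq_le)
  also have "\<dots> = 12 * 6 ^ M" by simp
  also have "(6::real) ^ M \<le> x powr (13 / 5)"
  proof -
    \<comment> \<open>The exponent 13/5 is a rational upper bound for log 6 / log 2, as 6^5 = 7776
      \<le> 8192 = 2^13.\<close>
    have "(6::real) = (6 ^ 5) powr (1 / 5)" by (simp add: powr_powr flip: powr_numeral)
    also have "\<dots> \<le> (2 ^ 13) powr (1 / 5)" by (rule powr_mono2) auto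
    also have "(2::real) ^ 13 = 2 powr 13" by simp
    also have "(2 powr 13) powr (1 / 5) = (2::real) powr (13 / 5)" by (simp only: powr_powr) simp
    finally have "(6::real) ^ M \<le> (2 powr (13 / 5)) ^ M" by (rule power_mono) simp
    also have "\<dots> = (2 ^ M) powr (13 / 5)"
      by (simp add: powr_powr mult.commute flip: powr_realpow)
    also have "\<dots> \<le> x powr (13 / 5)" using lower by (intro powr_mono2) auto
    finally show ?thesis .
  qed
  finally show ?thesis by simp
qed

lemma le_nat_floor_iff:
  fixes x :: real
  assumes "0 \<le> x"
  shows "n \<le> nat \<lfloor>x\<rfloor> \<longleftrightarrow> real n \<le> x"
  using assms by (simp add: le_nat_iff le_floor_iff)

text \<open>Chebyshev's inequality after a cut at y = x^(19/20): integers up to y are counted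
  trivially, and beyond y each exceptional n contributes at least y^(19/10) to the mean square. The
  constant is 1 + 12.\<close>

lemma card_tm_conv_large_le:
  assumes "x \<ge> 1" and "\<theta> \<le> 1 / 20"
  shows "real (card {n. 1 \<le> n \<and> real n \<le> x \<and> real n powr (1 - \<theta>) \<le> \<bar>tm_conv n\<bar>})
    \<le> 13 * x powr (19 / 20)"
proof -
  define y where "y = x powr (19 / 20)"
  define B where "B = {n. real n \<le> x \<and> y < real n \<and> real n powr (1 - \<theta>) \<le> \<bar>tm_conv n\<bar>}"
  have y: "y \<ge> 1" unfolding y_def using assms by (simp add: ge_one_powr_ge_zero)
  have fin: "finite {n. real n \<le> z}" for z
    by (rule finite_subset[of _ "{..nat \<lfloor>z\<rfloor>}"]) (auto simp: le_nat_floor)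
  have finB: "finite B" unfolding B_def by (rule finite_subset[OF _ fin[of x]]) auto
  have "real (card B) * x powr (361 / 200) = (\<Sum>n\<in>B. x powr (361 / 200))" by simp
  also have "\<dots> \<le> (\<Sum>n\<in>B. (tm_conv n)\<^sup>2)"
  proof (rule sum_mono)
    fix n assume "n \<in> B"
    then have n: "y < real n" and c: "real n powr (1 - \<theta>) \<le> \<bar>tm_conv n\<bar>"
      by (auto simp: B_def)
    have "x powr (361 / 200) = y powr (19 / 10)"
      by (simp add: y_def powr_powr)
    also have "\<dots> \<le> real n powr (19 / 10)"
      using n y by (intro powr_mono2) auto
    also have "\<dots> \<le> real n powr (2 * (1 - \<theta>))"
      using n y assms by (intro powr_mono) auto
    also have "\<dots> = (real n powr (1 - \<theta>))\<^sup>2"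
      by (simp add: power2_eq_square flip: powr_add)
    also have "\<dots> \<le> \<bar>tm_conv n\<bar>\<^sup>2" using c by (intro power_mono) auto
    finally show "x powr (361 / 200) \<le> (tm_conv n)\<^sup>2" by simp
  qed
  also have "\<dots> \<le> (\<Sum>n | real n \<le> x. (tm_conv n)\<^sup>2)"
    by (rule sum_mono2) (auto simp: fin B_def)
  also have "\<dots> \<le> 12 * x powr (13 / 5)" by (rule sum_tm_conv_sq_le_powr[OF assms(1)])
  \<comment> \<open>In 200ths the exponents are 520 \<le> 190 + 361 = 551.\<close>
  also have "\<dots> \<le> 12 * x powr (19 / 20 + 361 / 200)"
    using assms by (intro mult_left_mono powr_mono) auto
  also have "\<dots> = 12 * y * x powr (361 / 200)"
    by (simp only: powr_add y_def mult.assoc)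
  finally have B: "real (card B) \<le> 12 * y"
    using assms by simp
  have "card {n. 1 \<le> n \<and> real n \<le> x \<and> real n powr (1 - \<theta>) \<le> \<bar>tm_conv n\<bar>}
      \<le> card ({1..nat \<lfloor>y\<rfloor>} \<union> B)"
  proof (rule card_mono)
    show "{n. 1 \<le> n \<and> real n \<le> x \<and> real n powr (1 - \<theta>) \<le> \<bar>tm_conv n\<bar>} \<subseteq> {1..nat \<lfloor>y\<rfloor>} \<union> B"
      using y by (auto simp: B_def le_nat_floor_iff)
  qed (simp add: finB)
  also have "\<dots> \<le> nat \<lfloor>y\<rfloor> + card B"
    using card_Un_le[of "{1..nat \<lfloor>y\<rfloor>}" B] by simp
  finally have "real (card {n. 1 \<le> n \<and> real n \<le> x \<and> real n powr (1 - \<theta>) \<le> \<bar>tm_conv n\<bar>})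
      \<le> real (nat \<lfloor>y\<rfloor>) + real (card B)" by linarith
  also have "real (nat \<lfloor>y\<rfloor>) \<le> y" using y by (intro of_nat_floor) simp
  finally show ?thesis using B by (simp add: y_def)
qed

theorem theorem1p1:
  fixes \<theta> :: real
  assumes "0 < \<theta>"
    and "\<theta> < (2 * ln 2 - ln 3) / (40 * ln 2 - 8 * ln 3)"
  shows "\<exists>\<delta> C C' :: real. \<delta> > 0 \<and> C > 0 \<and> C' > 0 \<and>
    (\<forall>x::real. x \<ge> 1 \<longrightarrow>
      \<bar>real (card {n::nat. 1 \<le> n \<and> real n \<le> x \<and>
          \<bar>real (R2 thue_morse_set n) - real n / 8\<bar> \<le> C * real n powr (1 - \<theta>)}) - x\<bar>
        \<le> C' * x powr (1 - \<delta>))"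
proof -
  have "ln 3 < ln (2 ^ 2 :: real)" by (subst ln_less_cancel_iff) auto
  also have "ln (2 ^ 2 :: real) = 2 * ln 2" by (subst ln_realpow) simp_all
  finally have "ln 3 < 2 * ln (2::real)" .
  moreover have "0 < ln (3::real)" by simp
  \<comment> \<open>For a = ln 2 and b = ln 3: the denominator is positive, and clearing it leaves 0
    \<le> 12 b.\<close>
  moreover have "(2 * a - b) / (40 * a - 8 * b) \<le> 1 / 20" if "b < 2 * a" "0 < b" for a b :: real
    using that by (simp add: divide_le_eq)
  ultimately have "(2 * ln 2 - ln 3) / (40 * ln 2 - 8 * ln 3) \<le> (1 / 20 :: real)" by blast
  then have \<theta>: "\<theta> \<le> 1 / 20" using assms by linarith
  let ?good = "\<lambda>n. \<bar>real (R2 thue_morse_set n) - real n / 8\<bar> \<le> 1 * real n powr (1 - \<theta>)"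
  have bad: "real n powr (1 - \<theta>) \<le> \<bar>tm_conv n\<bar>" if "1 \<le> n" "\<not> ?good n" for n
  proof -
    define p where "p = real n powr (1 - \<theta>)"
    have "1 \<le> p" unfolding p_def using that \<theta> by (simp add: ge_one_powr_ge_zero)
    moreover have "8 * p < \<bar>tm_conv n\<bar> + 5"
      using that(2) abs_R2_thue_morse_diff_le[of n] by (simp add: p_def)
    \<comment> \<open>Here |c(n)| > 8p - 5 \<ge> 3p because p \<ge> 1, so C = 1 suffices.\<close>
    ultimately show ?thesis by (simp flip: p_def)
  qed
  have main: "\<bar>real (card {n. 1 \<le> n \<and> real n \<le> x \<and> ?good n}) - x\<bar> \<le> 14 * x powr (1 - 1 / 20)"
    if x: "x \<ge> 1" for x
  proof -
    let ?G = "{n. 1 \<le> n \<and> real n \<le> x \<and> ?good n}"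
    let ?B = "{n. 1 \<le> n \<and> real n \<le> x \<and> real n powr (1 - \<theta>) \<le> \<bar>tm_conv n\<bar>}"
    have sub: "?G \<subseteq> {1..nat \<lfloor>x\<rfloor>}" "?B \<subseteq> {1..nat \<lfloor>x\<rfloor>}"
      using x by (auto simp: le_nat_floor_iff)
    have cover: "{1..nat \<lfloor>x\<rfloor>} \<subseteq> ?G \<union> ?B"
    proof
      fix n assume "n \<in> {1..nat \<lfloor>x\<rfloor>}"
      then have "1 \<le> n" "real n \<le> x" using x by (simp_all add: le_nat_floor_iff)
      then show "n \<in> ?G \<union> ?B" using bad[of n] by blast
    qed
    have "card ?G \<le> nat \<lfloor>x\<rfloor>" using card_mono[OF _ sub(1)] by simp
    moreover have "nat \<lfloor>x\<rfloor> \<le> card ?G + card ?B"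
    proof -
      have "card {1..nat \<lfloor>x\<rfloor>} \<le> card (?G \<union> ?B)"
        using sub cover by (intro card_mono) (auto intro: finite_subset)
      also have "\<dots> \<le> card ?G + card ?B" by (rule card_Un_le)
      finally show ?thesis by simp
    qed
    \<comment> \<open>The 1 pays for rounding x down; absorbed into \<open>x powr (19 / 20)\<close>,
      it turns 13 into 14.\<close>
    ultimately have "\<bar>real (card ?G) - x\<bar> \<le> 1 + real (card ?B)"
      using x by linarith
    moreover have "real (card ?B) \<le> 13 * x powr (19 / 20)"
      by (rule card_tm_conv_large_le[OF x \<theta>])
    moreover have "1 \<le> x powr (19 / 20)" using x by (simp add: ge_one_powr_ge_zero)
    ultimately show ?thesis by simp
  qed
  show ?thesis
    by (rule exI[of _ "1 / 20"], rule exI[of _ 1], rule exI[of _ 14]) (use main in auto)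
qed

end
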